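(* Let $(X,*_X,0_X)$ and $(Y,*_Y,0_Y)$ be BCK/BCI-algebras and let $h:X\to Y$ be a homomorphism. If $h$ is a bijection and $\|\cdot\|_f:X\times(0,\infty)\to[0,1]$ is a fuzzy BCK/BCI-norm on $X$, then the mapping $\|\cdot\|_g:Y\times(0,\infty)\to[0,1]$ defined by $\|(y,t)\|_g=\|(h^{-1}(y),t)\|_f$ for all $y\in Y$ and $t>0$ is a fuzzy BCK/BCI-norm on $Y$.
   Context: A BCI-algebra is a set $X$ with a binary operation $*$ and a distinguished element $0$ such that for all $a,b,c\in X$: (I1) $((a*b)*(a*c))*(c*b)=0$; (I2) $(a*(a*b))*b=0$; (I3) $a*a=0$; (I4) $a*b=0$ and $b*a=0$ imply $a=b$. A BCK-algebra is a BCI-algebra that also satisfies (K): $0*a=0$ for all $a\in X$. "BCK/BCI-algebra" means a BCK-algebra or a BCI-algebra. A homomorphism $h:X\to Y$ of BCK/BCI-algebras is a map with $h(a*_X b)=h(a)*_Y h(b)$ for all $a,b\in X$ (hence $h(0_X)=0_Y$). For a BCK-algebra or BCI-algebra $(X,*,0)$, a fuzzy BCK/BCI-norm on $X$ is a mapping $\|\cdot\|_f : X\times(0,\infty)\to[0,1]$, with values written $\|(x,t)\|_f$, satisfying for all $x,y,z\in X$ and $s,t\in(0,\infty)$: (FN1) $\|(x,t)\|_f=1$ if and only if $x=0$; (FN2) if $t\ge s$ then $\|(x,t)\|_f\ge\|(x,s)\|_f$; (FN3) $\lim_{t\to\infty}\|(x,t)\|_f=1$; (FN4) $\|(x*z,s+t)\|_f\ge\min\{\|(x*y,s)\|_f,\|(y*z,t)\|_f\}$.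 *)

theory Defs
  imports Complex_Main "HOL-Library.FuncSet"
begin

locale bci_algebra =
  fixes X :: "'a set"
    and star :: "'a \<Rightarrow> 'a \<Rightarrow> 'a"  (infixl "\<star>" 70)
    and zero :: 'a  ("\<zero>")
  assumes zero_closed: "\<zero> \<in> X"
    and star_closed: "a \<in> X \<Longrightarrow> b \<in> X \<Longrightarrow> a \<star> b \<in> X"
    and I1: "a \<in> X \<Longrightarrow> b \<in> X \<Longrightarrow> c \<in> X \<Longrightarrow> ((a \<star> b) \<star> (a \<star> c)) \<star> (c \<star> b) = \<zero>"
    and I2: "a \<in> X \<Longrightarrow> b \<in> X \<Longrightarrow> (a \<star> (a \<star> b)) \<star> b = \<zero>"
    and I3: "a \<in> X \<Longrightarrow> a \<star> a = \<zero>"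
    and I4: "a \<in> X \<Longrightarrow> b \<in> X \<Longrightarrow> a \<star> b = \<zero> \<Longrightarrow> b \<star> a = \<zero> \<Longrightarrow> a = b"

locale bck_algebra = bci_algebra +
  assumes K: "a \<in> X \<Longrightarrow> \<zero> \<star> a = \<zero>"

definition bck_bci_algebra :: "'a set \<Rightarrow> ('a \<Rightarrow> 'a \<Rightarrow> 'a) \<Rightarrow> 'a \<Rightarrow> bool" where
  "bck_bci_algebra X star zero \<longleftrightarrow> bck_algebra X star zero \<or> bci_algebra X star zero"

definition bck_bci_hom ::
  "'a set \<Rightarrow> ('a \<Rightarrow> 'a \<Rightarrow> 'a) \<Rightarrow> 'b set \<Rightarrow> ('b \<Rightarrow> 'b \<Rightarrow> 'b) \<Rightarrow> ('a \<Rightarrow> 'b) \<Rightarrow> bool" where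
  "bck_bci_hom X starX Y starY h \<longleftrightarrow>
     h \<in> X \<rightarrow> Y \<and> (\<forall>a\<in>X. \<forall>b\<in>X. h (starX a b) = starY (h a) (h b))"

text \<open>
  Only the values of the norm on \<open>X \<times> {0<..}\<close> are constrained; its values elsewhere are irrelevant.
\<close>

locale fuzzy_bck_bci_norm =
  fixes X :: "'a set"
    and star :: "'a \<Rightarrow> 'a \<Rightarrow> 'a"  (infixl "\<star>" 70)
    and zero :: 'a  ("\<zero>")
    and N :: "'a \<times> real \<Rightarrow> real"
  assumes algebra: "bck_bci_algebra X star zero"
    and range: "N \<in> X \<times> {0<..} \<rightarrow> {0..1}"
    and FN1: "x \<in> X \<Longrightarrow> t > 0 \<Longrightarrow> N (x, t) = 1 \<longleftrightarrow> x = \<zero>"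
    and FN2: "x \<in> X \<Longrightarrow> s > 0 \<Longrightarrow> t > 0 \<Longrightarrow> t \<ge> s \<Longrightarrow> N (x, t) \<ge> N (x, s)"
    and FN3: "x \<in> X \<Longrightarrow> ((\<lambda>t. N (x, t)) \<longlongrightarrow> 1) at_top"
    and FN4: "x \<in> X \<Longrightarrow> y \<in> X \<Longrightarrow> z \<in> X \<Longrightarrow> s > 0 \<Longrightarrow> t > 0 \<Longrightarrow>
      N (x \<star> z, s + t) \<ge> min (N (x \<star> y, s)) (N (y \<star> z, t))"

end

theory Submission
  imports Defs
begin

text \<open>The inverse k of a bijective homomorphism h is itself a homomorphism
  (\<open>bck_bci_hom_inv_into\<close>), and g is f composed with k in the first argument. A fuzzy
  norm pulls back along any injective homomorphism k (\<open>fuzzy_bck_bci_norm_pullback\<close>):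
  the range condition, FN2 and FN3 concern one point at a time and carry over directly, FN4 carries
  over because k respects the operation, and FN1 because k sends zero, and only zero, to zero. Since
  a BCK-algebra is in particular a BCI-algebra, the BCI axioms serve both cases.\<close>

lemma bck_bci_algebra_imp_bci: "bck_bci_algebra X star zero \<Longrightarrow> bci_algebra X star zero"
  by (auto simp: bck_bci_algebra_def bck_algebra_def)

text \<open>By I3 zero is the product of any element with itself, and a homomorphism preserves such
  products.\<close>

lemma bck_bci_hom_zero:
  assumes "bck_bci_algebra X starX zeroX" "bck_bci_algebra Y starY zeroY"
    and "bck_bci_hom X starX Y starY h"
  shows "h zeroX = zeroY"
proof -
  interpret X: bci_algebra X starX zeroX
    using assms(1) by (rule bck_bci_algebra_imp_bci)
  interpret Y: bci_algebra Y starY zeroY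
    using assms(2) by (rule bck_bci_algebra_imp_bci)
  have "h zeroX = h (starX zeroX zeroX)"
    by (simp add: X.I3 X.zero_closed)
  also have "\<dots> = starY (h zeroX) (h zeroX)"
    using assms(3) X.zero_closed by (simp add: bck_bci_hom_def)
  also have "\<dots> = zeroY"
    using assms(3) X.zero_closed by (intro Y.I3) (auto simp: bck_bci_hom_def)
  finally show ?thesis .
qed

lemma bck_bci_hom_inv_into:
  assumes "bck_bci_algebra X starX zeroX"
    and "bck_bci_hom X starX Y starY h" "bij_betw h X Y"
  shows "bck_bci_hom Y starY X starX (inv_into X h)"
  unfolding bck_bci_hom_def
proof (intro conjI ballI funcsetI)
  interpret X: bci_algebra X starX zeroX
    using assms(1) by (rule bck_bci_algebra_imp_bci)
  let ?k = "inv_into X h"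
  show k: "?k y \<in> X" if "y \<in> Y" for y
    using that bij_betwE[OF bij_betw_inv_into[OF assms(3)]] by blast
  fix a b assume ab: "a \<in> Y" "b \<in> Y"
  \<comment> \<open>It suffices to compare images under h; cancelling h afterwards requires the
    product of the preimages to lie in X, hence \<open>X.star_closed\<close>.\<close>
  have "h (starX (?k a) (?k b)) = starY a b"
    using ab k assms(2) bij_betw_inv_into_right[OF assms(3)] by (simp add: bck_bci_hom_def)
  then show "?k (starY a b) = starX (?k a) (?k b)"
    using bij_betw_inv_into_left[OF assms(3) X.star_closed[OF k[OF ab(1)] k[OF ab(2)]]] by simp
qed

text \<open>The transfer is stated for an arbitrary injective homomorphism k from Y into X, so that
  no inverse function appears in the verification of the axioms.\<close>

lemma fuzzy_bck_bci_norm_pullback: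
  assumes "fuzzy_bck_bci_norm X starX zeroX f" "bck_bci_algebra Y starY zeroY"
    and hom: "bck_bci_hom Y starY X starX k" and inj: "inj_on k Y"
    and g: "\<And>y t. y \<in> Y \<Longrightarrow> t > 0 \<Longrightarrow> g (y, t) = f (k y, t)"
  shows "fuzzy_bck_bci_norm Y starY zeroY g"
proof -
  interpret X: fuzzy_bck_bci_norm X starX zeroX f by fact
  interpret Y: bci_algebra Y starY zeroY
    using assms(2) by (rule bck_bci_algebra_imp_bci)
  have k: "k y \<in> X" if "y \<in> Y" for y
    using hom that by (auto simp: bck_bci_hom_def)
  have k_star: "k (starY a b) = starX (k a) (k b)" if "a \<in> Y" "b \<in> Y" for a b
    using hom that by (simp add: bck_bci_hom_def)
  \<comment> \<open>The kernel of k is trivial: k maps zero to zero, and injectivity excludes any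
    other preimage. FN1 rests on this.\<close>
  have k_zero: "k y = zeroX \<longleftrightarrow> y = zeroY" if "y \<in> Y" for y
    using bck_bci_hom_zero[OF assms(2) X.algebra hom] inj_on_eq_iff[OF inj that Y.zero_closed]
    by simp
  show ?thesis
  proof
    show "bck_bci_algebra Y starY zeroY" by fact
    show "g \<in> Y \<times> {0<..} \<rightarrow> {0..1}"
    proof
      fix p assume "p \<in> Y \<times> {0::real<..}"
      then obtain y t where p: "p = (y, t)" and yt: "y \<in> Y" "t > 0" by auto
      then have "(k y, t) \<in> X \<times> {0<..}" using k by simp
      from funcset_mem[OF X.range this] show "g p \<in> {0..1}"
        using g[OF yt] p by simp
    qed
    show "g (y, t) = 1 \<longleftrightarrow> y = zeroY" if "y \<in> Y" "t > 0" for y t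
      using that by (simp add: g k X.FN1 k_zero)
    show "g (y, t) \<ge> g (y, s)" if "y \<in> Y" "s > 0" "t > 0" "t \<ge> s" for y s t
      using that by (simp add: g k X.FN2)
    show "((\<lambda>t. g (y, t)) \<longlongrightarrow> 1) at_top" if "y \<in> Y" for y
    \<comment> \<open>The functions of t are known to agree only for positive t, so the limit passes
      through eventual equality at infinity.\<close>
    proof (rule Lim_transform_eventually[OF X.FN3[OF k[OF that]]])
      show "\<forall>\<^sub>F t in at_top. f (k y, t) = g (y, t)"
        using eventually_gt_at_top[of 0] by eventually_elim (simp add: g that)
    qed
    show "g (starY x z, s + t) \<ge> min (g (starY x y, s)) (g (starY y z, t))"
      if "x \<in> Y" "y \<in> Y" "z \<in> Y" "s > 0" "t > 0" for x y z s t
      \<comment> \<open>This is FN4 for f at the images of x, y, z. Closure of Y is used because g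
        is tied to f only at points of Y.\<close>
      using X.FN4[OF k k k, of x y z s t] that by (simp add: g k_star Y.star_closed)
  qed
qed

theorem theorem3p17:
  fixes X :: "'a set" and starX :: "'a \<Rightarrow> 'a \<Rightarrow> 'a" and zeroX :: 'a
    and Y :: "'b set" and starY :: "'b \<Rightarrow> 'b \<Rightarrow> 'b" and zeroY :: 'b
    and h :: "'a \<Rightarrow> 'b"
    and f :: "'a \<times> real \<Rightarrow> real" and g :: "'b \<times> real \<Rightarrow> real"
  assumes "bck_bci_algebra X starX zeroX"
    and "bck_bci_algebra Y starY zeroY"
    and "bck_bci_hom X starX Y starY h"
    and "bij_betw h X Y"
    and "fuzzy_bck_bci_norm X starX zeroX f"
    and "\<And>y t. y \<in> Y \<Longrightarrow> t > 0 \<Longrightarrow> g (y, t) = f (inv_into X h y, t)"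
  shows "fuzzy_bck_bci_norm Y starY zeroY g"
  \<comment> \<open>Here k is \<open>inv_into X h\<close>, injective on Y because it is a bijection
    from Y to X.\<close>
  by (rule fuzzy_bck_bci_norm_pullback[OF assms(5) assms(2)
        bck_bci_hom_inv_into[OF assms(1,3,4)]
        bij_betw_imp_inj_on[OF bij_betw_inv_into[OF assms(4)]] assms(6)])

end
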